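(* For every $R>0$ there is a constant $C_R>0$ depending only on $R$ such that the following holds. Let $u$ be a smooth axisymmetric velocity field on $\mathbb{R}^3$ without swirl satisfying $\nabla\cdot u=0$, with vorticity $\nabla\times u=w^\theta e_\theta$. Then for any $p\in(1,\infty)$, $$\|u\|_{L^p(B_R\times[-R,R])}\le C_R\,\Big\|\frac{w^\theta}{r}\Big\|_{L^1\cap L^p(\mathbb{R}^3)},$$ where $B_R=B_R(0)\subset\mathbb{R}^2$ is the two-dimensional ball of radius $R$ centred at the origin.
   Context: Cylindrical coordinates on $\mathbb{R}^3$ are $(r,\theta,z)$ with $e_r=(\cos\theta,\sin\theta,0)$, $e_\theta=(-\sin\theta,\cos\theta,0)$, $e_z=(0,0,1)$. An axisymmetric velocity field without swirl has the form $u=u_r(r,z)e_r+u_z(r,z)e_z$ (time, if present, is a parameter). Its vorticity is $\nabla\times u=w^\theta e_\theta$ with $w^\theta=w_\theta=\partial_z u_r-\partial_r u_z$. The norm on $L^1\cap L^p$ is $\|f\|_{L^1\cap L^p}=\|f\|_{L^1}+\|f\|_{L^p}$, all with respect to Lebesgue measure on $\mathbb{R}^3$; the inequality is understood to be for fields with finite right-hand side. Standing assumption: $u$ is recovered from its vorticity, i.e. $u=\nabla\times(\psi e_\theta)$, where the stream function $\psi=\psi(r,z)$ vanishes on the axis $r=0$, satisfies $-\Delta(\psi e_\theta)=w^\theta e_\theta$, and is given by the absolutely convergent integral $\psi e_\theta(X)=\int_{\mathbb{R}^3}\frac{1}{4\pi|X-Y|}\,w^\theta(Y)e_\theta(Y)\,dY$.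 *)

theory Defs
  imports "HOL-Analysis.Analysis"
begin

definition partial :: "3 \<Rightarrow> (real^3 \<Rightarrow> real^3) \<Rightarrow> real^3 \<Rightarrow> real^3" where
  "partial i F X = frechet_derivative F (at X) (axis i 1)"

fun C_class :: "nat \<Rightarrow> (real^3 \<Rightarrow> real^3) \<Rightarrow> bool" where
  "C_class 0 F \<longleftrightarrow> continuous_on UNIV F"
| "C_class (Suc k) F \<longleftrightarrow> (\<forall>X. F differentiable (at X)) \<and> (\<forall>i. C_class k (partial i F))"

definition smooth :: "(real^3 \<Rightarrow> real^3) \<Rightarrow> bool" where
  "smooth F \<longleftrightarrow> (\<forall>k. C_class k F)"

definition divergence :: "(real^3 \<Rightarrow> real^3) \<Rightarrow> real^3 \<Rightarrow> real" where
  "divergence F X = (\<Sum>i\<in>UNIV. partial i F X $ i)"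

definition curl :: "(real^3 \<Rightarrow> real^3) \<Rightarrow> real^3 \<Rightarrow> real^3" where
  "curl F X = vector
     [partial 2 F X $ 3 - partial 3 F X $ 2,
      partial 3 F X $ 1 - partial 1 F X $ 3,
      partial 1 F X $ 2 - partial 2 F X $ 1]"

definition laplacian :: "(real^3 \<Rightarrow> real^3) \<Rightarrow> real^3 \<Rightarrow> real^3" where
  "laplacian F X = (\<Sum>i\<in>UNIV. partial i (partial i F) X)"

definition rad :: "real^3 \<Rightarrow> real" where
  "rad X = sqrt ((X $ 1)\<^sup>2 + (X $ 2)\<^sup>2)"

text \<open>On the axis the angle is undefined; \<^term>\<open>Arg 0 = 0\<close> selects an arbitrary value there.\<close>

definition ang :: "real^3 \<Rightarrow> real" where
  "ang X = Arg (Complex (X $ 1) (X $ 2))"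

definition e_r :: "real \<Rightarrow> real^3" where
  "e_r \<theta> = vector [cos \<theta>, sin \<theta>, 0]"

definition e_theta :: "real \<Rightarrow> real^3" where
  "e_theta \<theta> = vector [- sin \<theta>, cos \<theta>, 0]"

definition e_z :: "real^3" where
  "e_z = vector [0, 0, 1]"

text \<open>Requiring the identity for every \<open>\<theta>\<close> also when \<open>r = 0\<close> makes the radial part vanish
  on the axis.\<close>

definition axisymmetric_no_swirl :: "(real^3 \<Rightarrow> real^3) \<Rightarrow> bool" where
  "axisymmetric_no_swirl u \<longleftrightarrow>
     (\<exists>ur uz :: real \<Rightarrow> real \<Rightarrow> real. \<forall>r\<ge>0. \<forall>\<theta> z.
        u (vector [r * cos \<theta>, r * sin \<theta>, z]) = ur r z *\<^sub>R e_r \<theta> + uz r z *\<^sub>R e_z)"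

text \<open>Scalars depending on \<open>(r, z)\<close> are functions of two real arguments, of which only the values
  with \<open>r \<ge> 0\<close> matter. The following are the scalar, and the field \<open>f e\<^sub>\<theta>\<close>, on the whole space.\<close>

definition axi :: "(real \<Rightarrow> real \<Rightarrow> real) \<Rightarrow> real^3 \<Rightarrow> real" where
  "axi f X = f (rad X) (X $ 3)"

definition swirl_field :: "(real \<Rightarrow> real \<Rightarrow> real) \<Rightarrow> real^3 \<Rightarrow> real^3" where
  "swirl_field f X = axi f X *\<^sub>R e_theta (ang X)"

text \<open>The differentiability clauses say that the curl and the Laplacian of \<open>\<psi> e\<^sub>\<theta>\<close> exist
  classically. The Bochner integral converges absolutely by definition of integrability.\<close>

definition stream_function ::
    "(real^3 \<Rightarrow> real^3) \<Rightarrow> (real \<Rightarrow> real \<Rightarrow> real) \<Rightarrow> (real \<Rightarrow> real \<Rightarrow> real) \<Rightarrow> bool" where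
  "stream_function u w \<psi> \<longleftrightarrow>
     (\<forall>z. \<psi> 0 z = 0) \<and>
     (\<forall>X. swirl_field \<psi> differentiable (at X)) \<and>
     (\<forall>i X. partial i (swirl_field \<psi>) differentiable (at X)) \<and>
     (\<forall>X. u X = curl (swirl_field \<psi>) X) \<and>
     (\<forall>X. - laplacian (swirl_field \<psi>) X = swirl_field w X) \<and>
     (\<forall>X. integrable lborel (\<lambda>Y. (1 / (4 * pi * norm (X - Y))) *\<^sub>R swirl_field w Y)) \<and>
     (\<forall>X. swirl_field \<psi> X =
        (LINT Y|lborel. (1 / (4 * pi * norm (X - Y))) *\<^sub>R swirl_field w Y))"

definition in_Lp :: "real \<Rightarrow> (real^3) set \<Rightarrow> (real^3 \<Rightarrow> 'b::real_normed_vector) \<Rightarrow> bool" where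
  "in_Lp p S f \<longleftrightarrow> set_borel_measurable lborel S f \<and>
     set_integrable lborel S (\<lambda>X. norm (f X) powr p)"

definition Lp_norm :: "real \<Rightarrow> (real^3) set \<Rightarrow> (real^3 \<Rightarrow> 'b::real_normed_vector) \<Rightarrow> real" where
  "Lp_norm p S f = (LINT X:S|lborel. norm (f X) powr p) powr (1 / p)"

definition L1_Lp_norm :: "real \<Rightarrow> (real^3 \<Rightarrow> 'b::real_normed_vector) \<Rightarrow> real" where
  "L1_Lp_norm p f = Lp_norm 1 UNIV f + Lp_norm p UNIV f"

definition cylinder :: "real \<Rightarrow> (real^3) set" where
  "cylinder R = {X. vector [X $ 1, X $ 2] \<in> ball (0 :: real^2) R \<and> X $ 3 \<in> {-R..R}}"

end

theory Submission
  imports Defs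
begin

text \<open>
The velocity is controlled pointwise by the vorticity through the Biot--Savart law, and the weight
\<open>r\<close> lost in passing from \<open>w\<close> to \<open>w / r\<close> is compensated by the decay of the kernel.

The field \<open>\<psi> e\<^sub>\<theta>\<close> is the Newtonian potential of \<open>w e\<^sub>\<theta>\<close>, so its curl satisfies
\<open>\<bar>u(X)\<bar> \<le> \<integral> \<bar>w(Y)\<bar> / \<bar>X - Y\<bar>\<^sup>2 dY\<close> (lemma \<open>biot_savart_bound\<close>). Put \<open>f = \<bar>w\<bar> / r\<close>. If \<open>X\<close> lies in the
cylinder and \<open>d = \<bar>X - Y\<bar>\<close>, then the distance from \<open>Y\<close> to the axis is at most \<open>R + d\<close>, and
\<open>(R + d) / d\<^sup>2\<close> is at most \<open>R + 1\<close> for \<open>d \<ge> 1\<close> and at most \<open>(R + 1) / d\<^sup>2\<close> for \<open>d < 1\<close>. Hence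
\<open>\<bar>u\<bar> \<le> (R + 1) (\<parallel>f\<parallel>\<^sub>1 + k * f)\<close> on the cylinder, where \<open>k(Z) = \<bar>Z\<bar>\<^sup>-\<^sup>2\<close> on the unit ball and \<open>0\<close> outside
(lemma \<open>inv_sq_potential_near_far\<close>). Since \<open>k\<close> is integrable in three dimensions, Young's inequality
bounds \<open>k * f\<close> in \<open>L\<^sup>p\<close> by the \<open>L\<^sup>p\<close> norm of \<open>f\<close>, while the constant \<open>\<parallel>f\<parallel>\<^sub>1\<close> lies in \<open>L\<^sup>p\<close> of a set of
finite measure (lemma \<open>near_far_convolution_bound\<close>). Both bounds are uniform in \<open>p\<close>.

The vorticity \<open>w e\<^sub>\<theta>\<close> has length \<open>\<bar>w\<bar>\<close> and is continuous because \<open>u\<close> is smooth; its local boundedness is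
what makes the singular part of a difference quotient of the potential vanish in the limit. Most
integrals are taken in \<open>[0, \<infinity>]\<close>, so that the membership of \<open>u\<close> in \<open>L\<^sup>p\<close> comes out together with the bound.
\<close>

section \<open>The inverse square kernel near the origin\<close>

definition inv_sq_near :: "real \<Rightarrow> real^3 \<Rightarrow> real" where
  "inv_sq_near s Z = (if norm Z < s then 1 / (norm Z)\<^sup>2 else 0)"

lemma inv_sq_near_nonneg: "0 \<le> inv_sq_near s Z"
  by (simp add: inv_sq_near_def)

lemma inv_sq_near_commute: "inv_sq_near s (X - Y) = inv_sq_near s (Y - X)"
  by (simp add: inv_sq_near_def norm_minus_commute)

lemma borel_measurable_inv_sq_near [measurable]: "inv_sq_near s \<in> borel_measurable borel"
  unfolding inv_sq_near_def[abs_def] by measurable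

lemma nn_integral_lborel_translate:
  fixes f :: "'a::euclidean_space \<Rightarrow> ennreal"
  assumes [measurable]: "f \<in> borel_measurable borel"
  shows "(\<integral>\<^sup>+Y. f (Y - X) \<partial>lborel) = (\<integral>\<^sup>+Z. f Z \<partial>lborel)"
proof -
  have "(\<integral>\<^sup>+Z. f Z \<partial>lborel) = (\<integral>\<^sup>+Z. f Z \<partial>distr lborel borel ((+) (- X)))"
    by (simp add: lborel_distr_plus)
  also have "\<dots> = (\<integral>\<^sup>+Y. f (- X + Y) \<partial>lborel)"
    by (rule nn_integral_distr) auto
  finally show ?thesis by simp
qed

text \<open>Cutting the ball into dyadic shells, the integrand is at most \<open>4 ^ (k + 1) / s\<^sup>2\<close> on the \<open>k\<close>-th, of volume
at most a multiple of \<open>s\<^sup>3 / 8 ^ k\<close>, and the geometric series converges. The linear growth in \<open>s\<close>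
is what makes the singular part of a difference quotient of the potential negligible; the value at
\<open>s = 1\<close> is the mass of the convolution kernel.\<close>
lemma nn_integral_inv_sq_near_le:
  assumes "s > 0"
  shows "(\<integral>\<^sup>+Z. ennreal (inv_sq_near s Z) \<partial>lborel) \<le> ennreal (8 * unit_ball_vol 3 * s)"
proof -
  define c where "c k = 4 ^ Suc k / s\<^sup>2" for k
  define B where "B k = ball (0::real^3) (s / 2 ^ k)" for k
  have [measurable]: "B k \<in> sets borel" for k by (simp add: B_def)
  have pointwise: "ennreal (inv_sq_near s Z) \<le> (\<Sum>k. ennreal (c k) * indicator (B k) Z)" for Z
  proof (cases "0 < norm Z \<and> norm Z < s")
    case False
    then have "inv_sq_near s Z = 0" by (auto simp: inv_sq_near_def)
    then show ?thesis by simp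
  next
    case True
    \<comment> \<open>the index of the dyadic shell that contains \<open>Z\<close>\<close>
    define P where "P n \<longleftrightarrow> s / 2 ^ Suc n \<le> norm Z" for n
    obtain n where "s / norm Z < 2 ^ n"
      using real_arch_pow[of 2 "s / norm Z"] by auto
    then have "s < 2 ^ n * norm Z" using True by (simp add: field_simps)
    moreover have "2 ^ n * norm Z \<le> 2 ^ Suc n * norm Z" by simp
    ultimately have "s \<le> 2 ^ Suc n * norm Z" by linarith
    then have "P n" by (simp add: P_def field_simps)
    define k where "k = (LEAST n. P n)"
    have "P k" unfolding k_def using \<open>P n\<close> by (rule LeastI)
    have "norm Z < s / 2 ^ k"
    proof (cases k)
      case (Suc j)
      then have "\<not> P j" using not_less_Least[of j P] by (simp add: k_def)
      then show ?thesis by (simp add: P_def Suc)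
    qed (use True in simp)
    then have "Z \<in> B k" by (simp add: B_def)
    have "(s / 2 ^ Suc k)\<^sup>2 \<le> (norm Z)\<^sup>2"
      using \<open>P k\<close> assms unfolding P_def by (intro power_mono) auto
    moreover have "0 < (s / 2 ^ Suc k)\<^sup>2" using assms by simp
    ultimately have "1 / (norm Z)\<^sup>2 \<le> 1 / (s / 2 ^ Suc k)\<^sup>2"
      by (intro divide_left_mono mult_pos_pos) auto
    also have "\<dots> = c k"
      by (simp add: c_def power_divide power2_eq_square flip: power_mult_distrib)
    finally have "ennreal (inv_sq_near s Z) \<le> ennreal (c k) * indicator (B k) Z"
      using True \<open>Z \<in> B k\<close> by (simp add: inv_sq_near_def ennreal_leI)
    also have "\<dots> \<le> (\<Sum>k. ennreal (c k) * indicator (B k) Z)"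
      using sum_le_suminf[OF summableI, of "{k}" "\<lambda>k. ennreal (c k) * indicator (B k) Z"]
      by (simp del: sum_mult_indicator)
    finally show ?thesis .
  qed
  have layer: "ennreal (c k) * emeasure lborel (B k) = ennreal (4 * unit_ball_vol 3 * s * (1 / 2) ^ k)" for k
  proof -
    have "emeasure lborel (B k) = ennreal (unit_ball_vol 3 * (s / 2 ^ k) ^ 3)"
      unfolding B_def using assms by (subst emeasure_ball) auto
    moreover have "(4::real) ^ k = 2 ^ k * 2 ^ k" by (simp flip: power_mult_distrib)
    then have "c k * (unit_ball_vol 3 * (s / 2 ^ k) ^ 3) = 4 * unit_ball_vol 3 * s * (1 / 2) ^ k"
      using assms by (simp add: c_def field_simps power2_eq_square power3_eq_cube)
    moreover have "0 \<le> c k" using assms by (simp add: c_def)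
    ultimately show ?thesis using assms by (simp flip: ennreal_mult)
  qed
  have sums: "(\<lambda>k. 4 * unit_ball_vol 3 * s * (1 / 2) ^ k) sums (4 * unit_ball_vol 3 * s * 2)"
    using geometric_sums[of "1/2::real"] by (intro sums_mult) simp
  have "(\<integral>\<^sup>+Z. ennreal (inv_sq_near s Z) \<partial>lborel)
      \<le> (\<integral>\<^sup>+Z. (\<Sum>k. ennreal (c k) * indicator (B k) Z) \<partial>lborel)"
    by (intro nn_integral_mono pointwise)
  also have "\<dots> = (\<Sum>k. \<integral>\<^sup>+Z. ennreal (c k) * indicator (B k) Z \<partial>lborel)"
    by (rule nn_integral_suminf) measurable
  also have "\<dots> = (\<Sum>k. ennreal (4 * unit_ball_vol 3 * s * (1 / 2) ^ k))"
    by (subst nn_integral_cmult_indicator) (simp_all add: layer)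
  also have "\<dots> = ennreal (4 * unit_ball_vol 3 * s * 2)"
    using assms sums by (subst suminf_ennreal2) (auto simp: sums_iff)
  finally show ?thesis by (simp add: mult_ac)
qed

section \<open>The gradient of a Newtonian potential\<close>

text \<open>The difference is at most \<open>h / (a * b)\<close>, and the product of the reciprocals is at most the sum of their
squares. The inequality survives the convention \<open>1 / 0 = 0\<close>: if one of the numbers is \<open>0\<close>, the other is at
most \<open>h\<close>. It therefore holds for the Newton kernel at every pair of points, its poles included.\<close>
lemma abs_diff_inverse_le:
  fixes a b h :: real
  assumes "0 \<le> a" "0 \<le> b" "\<bar>a - b\<bar> \<le> h"
  shows "\<bar>1 / a - 1 / b\<bar> \<le> h * (1 / a\<^sup>2 + 1 / b\<^sup>2)"
proof (cases "a = 0 \<or> b = 0")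
  case True
  have one: "1 / x \<le> h * (1 / x\<^sup>2)" if "0 \<le> x" "x \<le> h" for x
    using that by (cases "x = 0") (simp_all add: field_simps power2_eq_square)
  from True one[of a] one[of b] assms show ?thesis by (auto simp: abs_if split: if_splits)
next
  case False
  then have pos: "0 < a" "0 < b" using assms by auto
  have "1 / a - 1 / b = (b - a) * ((1 / a) * (1 / b))"
    using pos by (simp add: field_simps)
  then have "\<bar>1 / a - 1 / b\<bar> = \<bar>a - b\<bar> * ((1 / a) * (1 / b))"
    using pos by (simp add: abs_mult abs_minus_commute)
  also have "\<dots> \<le> h * ((1 / a) * (1 / b))"
    using assms pos by (intro mult_right_mono) auto
  also have "\<dots> \<le> h * ((1 / a)\<^sup>2 + (1 / b)\<^sup>2)"
  proof (rule mult_left_mono)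
    have "0 \<le> (1 / a) * (1 / b)" using pos by simp
    moreover have "2 * ((1 / a) * (1 / b)) \<le> (1 / a)\<^sup>2 + (1 / b)\<^sup>2"
      using sum_squares_bound[of "1 / a" "1 / b"] by (simp only: mult.assoc)
    ultimately show "(1 / a) * (1 / b) \<le> (1 / a)\<^sup>2 + (1 / b)\<^sup>2" by linarith
  qed (use assms in auto)
  finally show ?thesis by (simp add: power_one_over)
qed

text \<open>Away from the pole, at distance at least twice the increment, \<open>\<bar>X + V - Y\<bar>\<close> and \<open>\<bar>X - Y\<bar>\<close> are
comparable, so that the increment of the kernel is controlled by the inverse square at \<open>X\<close> alone.\<close>
lemma newton_kernel_diff_le:
  fixes X Y V :: "real^3"
  assumes "2 * norm V \<le> norm (X - Y)"
  shows "\<bar>1 / norm (X + V - Y) - 1 / norm (X - Y)\<bar> \<le> norm V * (2 / (norm (X - Y))\<^sup>2)"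
proof (cases "X = Y")
  case True
  then show ?thesis using assms by simp
next
  case False
  define a b where "a = norm (X + V - Y)" and "b = norm (X - Y)"
  have ab: "\<bar>b - a\<bar> \<le> norm V" "b \<le> 2 * a" "0 < b" "0 < a"
    using norm_triangle_ineq3[of "X - Y" "X + V - Y"] assms False
    by (auto simp: a_def b_def)
  have "1 / a - 1 / b = (b - a) * ((1 / a) * (1 / b))"
    using ab by (simp add: field_simps)
  then have "\<bar>1 / a - 1 / b\<bar> = \<bar>b - a\<bar> * ((1 / a) * (1 / b))"
    using ab by (simp add: abs_mult)
  also have "\<dots> \<le> norm V * ((2 / b) * (1 / b))"
    using ab by (intro mult_mono) (auto simp: field_simps)
  finally show ?thesis by (simp add: a_def b_def power2_eq_square)
qed

definition inv_sq_potential :: "(real^3 \<Rightarrow> real) \<Rightarrow> real^3 \<Rightarrow> ennreal" where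
  "inv_sq_potential g X = (\<integral>\<^sup>+Y. ennreal (g Y / (norm (X - Y))\<^sup>2) \<partial>lborel)"

definition has_newton_potential :: "(real^3 \<Rightarrow> real^3) \<Rightarrow> (real^3 \<Rightarrow> real^3) \<Rightarrow> bool" where
  "has_newton_potential F \<Psi> \<longleftrightarrow> (\<forall>X.
     integrable lborel (\<lambda>Y. (1 / (4 * pi * norm (X - Y))) *\<^sub>R F Y) \<and>
     \<Psi> X = (LINT Y|lborel. (1 / (4 * pi * norm (X - Y))) *\<^sub>R F Y))"

text \<open>The integral is split at distance \<open>2 \<bar>V\<bar>\<close> from \<open>X\<close>. The far part has the size of the inverse square
potential. In the near part both poles occur, but there the density is bounded by \<open>M\<close> and the two
kernels live on balls of radius \<open>3 \<bar>V\<bar>\<close> and \<open>2 \<bar>V\<bar>\<close>, which gains an additional factor \<open>\<bar>V\<bar>\<close>.\<close>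
lemma newton_potential_increment_le:
  assumes [measurable]: "F \<in> borel_measurable borel"
    and newton: "has_newton_potential F \<Psi>"
    and "V \<noteq> 0" and M: "0 \<le> M" "\<And>Y. norm (X - Y) < 2 * norm V \<Longrightarrow> norm (F Y) \<le> M"
  shows "ennreal (norm (\<Psi> (X + V) - \<Psi> X))
    \<le> ennreal (norm V / (4 * pi)) *
      (2 * inv_sq_potential (\<lambda>Y. norm (F Y)) X + ennreal (M * (40 * unit_ball_vol 3 * norm V)))"
proof -
  define h where "h = norm V"
  have h: "0 < h" using \<open>V \<noteq> 0\<close> by (simp add: h_def)
  define N where "N X Y = (1 / (4 * pi * norm (X - Y))) *\<^sub>R F Y" for X Y
  have int: "integrable lborel (N X)" and eq: "\<Psi> X = (LINT Y|lborel. N X Y)" for X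
    using newton by (auto simp: has_newton_potential_def N_def[abs_def])
  have pointwise: "norm (N (X + V) Y - N X Y) \<le> (h / (4 * pi)) * (2 * (norm (F Y) / (norm (X - Y))\<^sup>2)
      + M * (inv_sq_near (3 * h) (Y - (X + V)) + inv_sq_near (2 * h) (Y - X)))" for Y
  proof -
    have "N (X + V) Y - N X Y = (1 / (4 * pi)) *\<^sub>R ((1 / norm (X + V - Y) - 1 / norm (X - Y)) *\<^sub>R F Y)"
      by (simp add: N_def scaleR_diff_left scaleR_diff_right)
    then have "norm (N (X + V) Y - N X Y)
        = (1 / (4 * pi)) * (\<bar>1 / norm (X + V - Y) - 1 / norm (X - Y)\<bar> * norm (F Y))"
      by simp
    also have "\<dots> \<le> (1 / (4 * pi)) * (h * (2 * (norm (F Y) / (norm (X - Y))\<^sup>2)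
      + M * (inv_sq_near (3 * h) (Y - (X + V)) + inv_sq_near (2 * h) (Y - X))))"
    proof (rule mult_left_mono)
      have near: "0 \<le> M * (inv_sq_near (3 * h) (Y - (X + V)) + inv_sq_near (2 * h) (Y - X))"
        using M by (simp add: inv_sq_near_nonneg)
      show "\<bar>1 / norm (X + V - Y) - 1 / norm (X - Y)\<bar> * norm (F Y)
        \<le> h * (2 * (norm (F Y) / (norm (X - Y))\<^sup>2)
          + M * (inv_sq_near (3 * h) (Y - (X + V)) + inv_sq_near (2 * h) (Y - X)))"
      proof (cases "norm (X - Y) < 2 * h")
        case True
        have "norm (X + V - Y) < 3 * h"
          using True norm_triangle_ineq[of "X - Y" V] by (simp add: h_def algebra_simps)
        then have kernels: "inv_sq_near (3 * h) (Y - (X + V)) = 1 / (norm (X + V - Y))\<^sup>2"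
            "inv_sq_near (2 * h) (Y - X) = 1 / (norm (X - Y))\<^sup>2"
          using True by (simp_all add: inv_sq_near_def norm_minus_commute)
        have "\<bar>norm (X + V - Y) - norm (X - Y)\<bar> \<le> h"
          using norm_triangle_ineq3[of "X + V - Y" "X - Y"] by (simp add: h_def)
        then have "\<bar>1 / norm (X + V - Y) - 1 / norm (X - Y)\<bar>
            \<le> h * (1 / (norm (X + V - Y))\<^sup>2 + 1 / (norm (X - Y))\<^sup>2)"
          by (intro abs_diff_inverse_le) auto
        then have "\<bar>1 / norm (X + V - Y) - 1 / norm (X - Y)\<bar> * norm (F Y)
            \<le> (h * (1 / (norm (X + V - Y))\<^sup>2 + 1 / (norm (X - Y))\<^sup>2)) * M"
          using M True h by (intro mult_mono) (auto simp: h_def)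
        also have "\<dots> = h * (M * (inv_sq_near (3 * h) (Y - (X + V)) + inv_sq_near (2 * h) (Y - X)))"
          unfolding kernels by (simp only: mult_ac)
        also have "\<dots> \<le> h * (2 * (norm (F Y) / (norm (X - Y))\<^sup>2)
          + M * (inv_sq_near (3 * h) (Y - (X + V)) + inv_sq_near (2 * h) (Y - X)))"
          using h by (intro mult_left_mono) auto
        finally show ?thesis .
      next
        case False
        then have "\<bar>1 / norm (X + V - Y) - 1 / norm (X - Y)\<bar> * norm (F Y)
            \<le> h * (2 / (norm (X - Y))\<^sup>2) * norm (F Y)"
          unfolding h_def by (intro mult_right_mono newton_kernel_diff_le) auto
        also have "\<dots> = h * (2 * (norm (F Y) / (norm (X - Y))\<^sup>2))" by simp
        also have "\<dots> \<le> h * (2 * (norm (F Y) / (norm (X - Y))\<^sup>2)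
          + M * (inv_sq_near (3 * h) (Y - (X + V)) + inv_sq_near (2 * h) (Y - X)))"
          using h near by (intro mult_left_mono) auto
        finally show ?thesis .
      qed
    qed simp
    finally show ?thesis by simp
  qed
  have near_part: "(\<integral>\<^sup>+Y. ennreal (inv_sq_near s (Y - Z)) \<partial>lborel) \<le> ennreal (8 * unit_ball_vol 3 * s)"
    if "0 < s" for s Z
    using nn_integral_inv_sq_near_le[OF that]
    by (subst nn_integral_lborel_translate[where f = "\<lambda>Y. ennreal (inv_sq_near s Y)"]) auto
  have "ennreal (norm (\<Psi> (X + V) - \<Psi> X)) = ennreal (norm (LINT Y|lborel. N (X + V) Y - N X Y))"
    using int by (simp add: eq)
  also have "\<dots> \<le> (\<integral>\<^sup>+Y. norm (N (X + V) Y - N X Y) \<partial>lborel)"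
    using int by (intro integral_norm_bound_ennreal) auto
  also have "\<dots> \<le> (\<integral>\<^sup>+Y. ennreal (h / (4 * pi)) * (2 * ennreal (norm (F Y) / (norm (X - Y))\<^sup>2)
      + ennreal M * (ennreal (inv_sq_near (3 * h) (Y - (X + V))) + ennreal (inv_sq_near (2 * h) (Y - X)))) \<partial>lborel)"
  proof (rule nn_integral_mono)
    fix Y
    have "ennreal (norm (N (X + V) Y - N X Y)) \<le> ennreal ((h / (4 * pi)) * (2 * (norm (F Y) / (norm (X - Y))\<^sup>2)
      + M * (inv_sq_near (3 * h) (Y - (X + V)) + inv_sq_near (2 * h) (Y - X))))"
      using pointwise by (rule ennreal_leI)
    also have "\<dots> = ennreal (h / (4 * pi)) * (ennreal 2 * ennreal (norm (F Y) / (norm (X - Y))\<^sup>2)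
      + ennreal M * (ennreal (inv_sq_near (3 * h) (Y - (X + V))) + ennreal (inv_sq_near (2 * h) (Y - X))))"
      using h M
      by (simp only: ennreal_mult[symmetric] ennreal_plus[symmetric] inv_sq_near_nonneg add_nonneg_nonneg mult_nonneg_nonneg
          zero_le_divide_iff zero_le_power2 norm_ge_zero zero_le_numeral pi_ge_zero less_imp_le simp_thms)
    finally show "ennreal (norm (N (X + V) Y - N X Y)) \<le> ennreal (h / (4 * pi)) * (2 * ennreal (norm (F Y) / (norm (X - Y))\<^sup>2)
      + ennreal M * (ennreal (inv_sq_near (3 * h) (Y - (X + V))) + ennreal (inv_sq_near (2 * h) (Y - X))))" by simp
  qed
  also have "\<dots> = ennreal (h / (4 * pi)) * (2 * inv_sq_potential (\<lambda>Y. norm (F Y)) X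
      + ennreal M * ((\<integral>\<^sup>+Y. ennreal (inv_sq_near (3 * h) (Y - (X + V))) \<partial>lborel)
        + (\<integral>\<^sup>+Y. ennreal (inv_sq_near (2 * h) (Y - X)) \<partial>lborel)))"
    by (simp add: nn_integral_cmult nn_integral_add inv_sq_potential_def)
  also have "\<dots> \<le> ennreal (h / (4 * pi)) * (2 * inv_sq_potential (\<lambda>Y. norm (F Y)) X
      + ennreal M * (ennreal (8 * unit_ball_vol 3 * (3 * h)) + ennreal (8 * unit_ball_vol 3 * (2 * h))))"
    using h by (intro mult_left_mono add_left_mono add_mono near_part) auto
  also have "ennreal M * (ennreal (8 * unit_ball_vol 3 * (3 * h)) + ennreal (8 * unit_ball_vol 3 * (2 * h)))
      = ennreal (M * (40 * unit_ball_vol 3 * h))"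
    using h M by (simp flip: ennreal_plus ennreal_mult)
  finally show ?thesis by (simp add: h_def)
qed

text \<open>Divide the bound on the increment by its length and let the length tend to \<open>0\<close>: the near part
disappears, since the density is bounded on the unit ball around \<open>X\<close>.\<close>
lemma newton_potential_derivative_le:
  assumes cont: "continuous_on UNIV F" and newton: "has_newton_potential F \<Psi>"
    and D: "(\<Psi> has_derivative D) (at X)" and "norm v = 1"
  shows "ennreal (norm (D v)) \<le> ennreal (1 / (2 * pi)) * inv_sq_potential (\<lambda>Y. norm (F Y)) X"
proof (cases "inv_sq_potential (\<lambda>Y. norm (F Y)) X")
  case top
  then show ?thesis by (simp add: ennreal_mult_top)
next
  case (real G)
  have [measurable]: "F \<in> borel_measurable borel"
    using cont by (rule borel_measurable_continuous_onI)
  have "bounded (F ` cball X 1)"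
    using cont by (intro compact_imp_bounded compact_continuous_image) (auto intro: continuous_on_subset)
  then obtain M where M: "0 < M" "\<And>Y. Y \<in> cball X 1 \<Longrightarrow> norm (F Y) \<le> M"
    by (auto simp: bounded_pos)
  interpret D: bounded_linear D using D by (rule has_derivative_bounded_linear)
  \<comment> \<open>the relative error of the linear approximation, which tends to \<open>0\<close>\<close>
  define e where "e V = norm (\<Psi> (X + V) - \<Psi> X - D V) / norm V" for V
  have "(e \<longlongrightarrow> 0) (at 0)"
    using D unfolding has_derivative_at e_def[abs_def] by auto
  moreover have "filterlim (\<lambda>t. t *\<^sub>R v) (at 0) (at_right 0)"
    unfolding filterlim_at
  proof
    show "((\<lambda>t. t *\<^sub>R v) \<longlongrightarrow> 0) (at_right 0)" by (auto intro!: tendsto_eq_intros)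
    show "\<forall>\<^sub>F t in at_right 0. t *\<^sub>R v \<in> UNIV \<and> t *\<^sub>R v \<noteq> 0"
      using eventually_at_right_less[of "0::real"] \<open>norm v = 1\<close> by (auto elim!: eventually_mono)
  qed
  ultimately have "((\<lambda>t. e (t *\<^sub>R v)) \<longlongrightarrow> 0) (at_right 0)"
    by (rule filterlim_compose)
  then have lim: "((\<lambda>t. e (t *\<^sub>R v) + (2 * G + M * (40 * unit_ball_vol 3 * t)) / (4 * pi))
      \<longlongrightarrow> 0 + (2 * G + M * (40 * unit_ball_vol 3 * 0)) / (4 * pi)) (at_right 0)"
    by (intro tendsto_intros) auto
  have "\<forall>\<^sub>F t in at_right 0. t < 1 / 2 \<and> 0 < (t::real)"
    by (intro eventually_conj eventually_at_right_less eventually_at_rightI[of 0 "1/2"]) auto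
  then have "\<forall>\<^sub>F t in at_right 0. norm (D v) \<le> e (t *\<^sub>R v) + (2 * G + M * (40 * unit_ball_vol 3 * t)) / (4 * pi)"
  proof eventually_elim
    case (elim t)
    then have nt: "norm (t *\<^sub>R v) = t" using \<open>norm v = 1\<close> by simp
    have "ennreal (norm (\<Psi> (X + t *\<^sub>R v) - \<Psi> X))
      \<le> ennreal (norm (t *\<^sub>R v) / (4 * pi)) *
        (2 * inv_sq_potential (\<lambda>Y. norm (F Y)) X + ennreal (M * (40 * unit_ball_vol 3 * norm (t *\<^sub>R v))))"
    proof (rule newton_potential_increment_le[OF _ newton])
      show "t *\<^sub>R v \<noteq> 0" using nt elim by auto
      show "norm (F Y) \<le> M" if "norm (X - Y) < 2 * norm (t *\<^sub>R v)" for Y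
        using that nt elim by (intro M) (auto simp: dist_norm)
    qed (use M in auto)
    also have "\<dots> = ennreal (t / (4 * pi)) * (ennreal 2 * ennreal G + ennreal (M * (40 * unit_ball_vol 3 * t)))"
      by (simp only: nt real) simp
    also have "\<dots> = ennreal (t / (4 * pi) * (2 * G + M * (40 * unit_ball_vol 3 * t)))"
      using elim real M by (simp add: ennreal_plus ennreal_mult del: times_divide_eq_left)
    finally have "norm (\<Psi> (X + t *\<^sub>R v) - \<Psi> X) \<le> t / (4 * pi) * (2 * G + M * (40 * unit_ball_vol 3 * t))"
      using elim real M by (subst (asm) ennreal_le_iff) auto
    moreover have "norm (D (t *\<^sub>R v)) \<le> norm (\<Psi> (X + t *\<^sub>R v) - \<Psi> X - D (t *\<^sub>R v)) + norm (\<Psi> (X + t *\<^sub>R v) - \<Psi> X)"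
      using norm_triangle_sub[of "D (t *\<^sub>R v)" "\<Psi> (X + t *\<^sub>R v) - \<Psi> X"] by (simp add: norm_minus_commute)
    moreover have "norm (\<Psi> (X + t *\<^sub>R v) - \<Psi> X - D (t *\<^sub>R v)) = t * e (t *\<^sub>R v)"
      using elim by (simp only: e_def nt) simp
    moreover have "norm (D (t *\<^sub>R v)) = t * norm (D v)" using elim by (simp add: D.scaleR)
    ultimately have "t * norm (D v) \<le> t * e (t *\<^sub>R v) + t / (4 * pi) * (2 * G + M * (40 * unit_ball_vol 3 * t))"
      by linarith
    also have "\<dots> = t * (e (t *\<^sub>R v) + (2 * G + M * (40 * unit_ball_vol 3 * t)) / (4 * pi))"
      by (simp only: distrib_left add_divide_distrib times_divide_eq_left times_divide_eq_right)
    finally show ?case using elim by simp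
  qed
  then have "norm (D v) \<le> 0 + (2 * G + M * (40 * unit_ball_vol 3 * 0)) / (4 * pi)"
    by (rule tendsto_lowerbound[OF lim]) simp
  then have "norm (D v) \<le> 1 / (2 * pi) * G" by simp
  then have "ennreal (norm (D v)) \<le> ennreal (1 / (2 * pi) * G)" by (rule ennreal_leI)
  also have "\<dots> = ennreal (1 / (2 * pi)) * ennreal G" using real by (intro ennreal_mult) auto
  finally show ?thesis by (simp only: real)
qed

text \<open>Each partial derivative enters two of the three components of the curl.\<close>
lemma norm_curl_le: "norm (curl F X) \<le> 2 * (\<Sum>i\<in>UNIV. norm (partial i F X))"
proof -
  have comp: "\<bar>partial i F X $ j - partial j F X $ i\<bar> \<le> norm (partial i F X) + norm (partial j F X)" for i j
    using component_le_norm_cart[of "partial i F X" j] component_le_norm_cart[of "partial j F X" i]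
      abs_triangle_ineq4[of "partial i F X $ j" "partial j F X $ i"] by linarith
  have "norm (curl F X) \<le> (\<Sum>i\<in>UNIV. \<bar>curl F X $ i\<bar>)" by (rule norm_le_l1_cart)
  also have "\<dots> \<le> 2 * (\<Sum>i\<in>UNIV. norm (partial i F X))"
    using comp[of 2 3] comp[of 3 1] comp[of 1 2] by (simp add: sum_3 curl_def)
  finally show ?thesis .
qed

text \<open>The sharp constant of the Biot--Savart law is \<open>1 / (4 * pi)\<close>. The estimates of the kernel and of the
curl lose constant factors, and what remains is \<open>3 / pi < 1\<close>.\<close>
lemma biot_savart_bound:
  assumes cont: "continuous_on UNIV F" and newton: "has_newton_potential F \<Psi>"
    and diff: "\<Psi> differentiable (at X)"
  shows "ennreal (norm (curl \<Psi> X)) \<le> inv_sq_potential (\<lambda>Y. norm (F Y)) X"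
proof (cases "inv_sq_potential (\<lambda>Y. norm (F Y)) X")
  case top
  then show ?thesis by simp
next
  case (real G)
  have partial_le: "norm (partial i \<Psi> X) \<le> G / (2 * pi)" for i
  proof -
    have "ennreal (norm (partial i \<Psi> X)) \<le> ennreal (1 / (2 * pi)) * ennreal G"
      unfolding partial_def real(2)[symmetric]
      using diff by (intro newton_potential_derivative_le[OF cont newton]) (auto simp: frechet_derivative_works)
    also have "\<dots> = ennreal (1 / (2 * pi) * G)" using real by (intro ennreal_mult[symmetric]) auto
    finally show ?thesis using real by (subst (asm) ennreal_le_iff) auto
  qed
  have "norm (curl \<Psi> X) \<le> 2 * (\<Sum>i\<in>UNIV. norm (partial i \<Psi> X))" by (rule norm_curl_le)
  also have "\<dots> \<le> 6 * (G / (2 * pi))"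
    using partial_le[of 1] partial_le[of 2] partial_le[of 3] by (simp add: sum_3)
  also have "\<dots> = G * (3 / pi)" by simp
  also have "\<dots> \<le> G * 1" using real pi_gt3 by (intro mult_left_mono) auto
  finally show ?thesis using real by (simp add: ennreal_leI)
qed

section \<open>Young's inequality for the truncated kernel\<close>

text \<open>Jensen's inequality for the measure \<open>k dM\<close>, in a form that allows both integrals to be infinite:
\<open>t\<close> is any lower bound of the integral of \<open>f\<close>. Apply the tangent line inequality
\<open>x \<le> s powr (1 - p) * x powr p / p + (1 - 1 / p) * s\<close> to \<open>x = f(y)\<close> at the level \<open>s = t / A\<close> and
integrate; then the last term contributes at most \<open>(1 - 1 / p) * t\<close> and is absorbed on the left.\<close>
lemma nn_integral_Jensen_powr:
  fixes k f :: "'a \<Rightarrow> real"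
  assumes [measurable]: "k \<in> borel_measurable M" "f \<in> borel_measurable M"
    and nonneg: "\<And>x. 0 \<le> k x" "\<And>x. 0 \<le> f x"
    and mass: "(\<integral>\<^sup>+x. ennreal (k x) \<partial>M) \<le> ennreal A" and "0 < A" and "1 < p"
    and t: "0 \<le> t" "ennreal t \<le> (\<integral>\<^sup>+x. ennreal (k x * f x) \<partial>M)"
  shows "ennreal (t powr p) \<le> ennreal (A powr (p - 1)) * (\<integral>\<^sup>+x. ennreal (k x * f x powr p) \<partial>M)"
proof (cases "t = 0 \<or> (\<integral>\<^sup>+x. ennreal (k x * f x powr p) \<partial>M) = \<infinity>")
  case True
  then show ?thesis using \<open>0 < A\<close> \<open>1 < p\<close> by (auto simp: ennreal_mult_top)
next
  case False
  then obtain Q where Q: "0 \<le> Q" "(\<integral>\<^sup>+x. ennreal (k x * f x powr p) \<partial>M) = ennreal Q"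
    by (cases "(\<integral>\<^sup>+x. ennreal (k x * f x powr p) \<partial>M)") auto
  define s where "s = t / A"
  have s: "0 < s" using False t \<open>0 < A\<close> by (simp add: s_def)
  have young: "x \<le> (s powr (1 - p) / p) * x powr p + (1 - 1 / p) * s" if "0 \<le> x" for x
  proof (cases "x = 0")
    case True
    then show ?thesis using s \<open>1 < p\<close> by simp
  next
    case False
    have "(x powr p * s powr (1 - p)) powr (1 / p) * s powr (1 - 1 / p)
        \<le> (1 / p) * (x powr p * s powr (1 - p)) + (1 - 1 / p) * s"
      using False that s \<open>1 < p\<close> by (intro Youngs_inequality_0) auto
    moreover have "(x powr p * s powr (1 - p)) powr (1 / p) * s powr (1 - 1 / p)
        = x * (s powr ((1 - p) / p) * s powr (1 - 1 / p))"
      using False that s \<open>1 < p\<close> by (simp add: powr_mult powr_powr)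
    moreover have "(1 - p) / p + (1 - 1 / p) = 0" using \<open>1 < p\<close> by (simp add: field_simps)
    then have "s powr ((1 - p) / p) * s powr (1 - 1 / p) = 1"
      using s by (simp flip: powr_add)
    ultimately show ?thesis by (simp add: mult.commute[of _ "s powr (1 - p)"]) 
  qed
  have "ennreal t \<le> (\<integral>\<^sup>+x. ennreal (k x * f x) \<partial>M)" by (rule t)
  also have "\<dots> \<le> (\<integral>\<^sup>+x. ennreal (s powr (1 - p) / p) * ennreal (k x * f x powr p)
      + ennreal ((1 - 1 / p) * s) * ennreal (k x) \<partial>M)"
  proof (rule nn_integral_mono)
    fix x
    have "k x * f x \<le> k x * ((s powr (1 - p) / p) * f x powr p + (1 - 1 / p) * s)"
      using young nonneg by (intro mult_left_mono) auto
    also have "\<dots> = (s powr (1 - p) / p) * (k x * f x powr p) + ((1 - 1 / p) * s) * k x"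
      by (simp add: algebra_simps)
    finally have "ennreal (k x * f x)
        \<le> ennreal ((s powr (1 - p) / p) * (k x * f x powr p) + ((1 - 1 / p) * s) * k x)"
      by (rule ennreal_leI)
    also have "\<dots> = ennreal (s powr (1 - p) / p) * ennreal (k x * f x powr p)
      + ennreal ((1 - 1 / p) * s) * ennreal (k x)"
      using nonneg s \<open>1 < p\<close> by (simp flip: ennreal_mult ennreal_plus)
    finally show "ennreal (k x * f x) \<le> \<dots>" .
  qed
  also have "\<dots> = ennreal (s powr (1 - p) / p) * ennreal Q
      + ennreal ((1 - 1 / p) * s) * (\<integral>\<^sup>+x. ennreal (k x) \<partial>M)"
    by (simp add: nn_integral_add nn_integral_cmult Q)
  also have "\<dots> \<le> ennreal (s powr (1 - p) / p) * ennreal Q + ennreal ((1 - 1 / p) * s) * ennreal A"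
    using mass by (intro add_left_mono mult_left_mono) auto
  also have "\<dots> = ennreal ((s powr (1 - p) / p) * Q + (1 - 1 / p) * t)"
    using Q s t \<open>0 < A\<close> \<open>1 < p\<close> by (simp add: s_def flip: ennreal_mult ennreal_plus)
  finally have "t \<le> (s powr (1 - p) / p) * Q + (1 - 1 / p) * t"
    using Q s t \<open>1 < p\<close> by (subst (asm) ennreal_le_iff) auto
  then have "t \<le> s powr (1 - p) * Q"
    using \<open>1 < p\<close> by (simp add: field_simps)
  then have "t * s powr (p - 1) \<le> (s powr (1 - p) * Q) * s powr (p - 1)"
    by (intro mult_right_mono) auto
  also have "\<dots> = Q" using s by (simp add: mult.assoc mult.left_commute flip: powr_add)
  also have "t * s powr (p - 1) = t powr p / A powr (p - 1)"
    using t \<open>0 < A\<close> False by (simp add: s_def powr_divide powr_diff field_simps)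
  finally have "t powr p \<le> A powr (p - 1) * Q"
    using \<open>0 < A\<close> by (simp add: field_simps)
  then show ?thesis using Q by (simp add: ennreal_leI flip: ennreal_mult)
qed

text \<open>Young's convolution inequality for a kernel of mass at most \<open>A = 8 * unit_ball_vol 3\<close>, together with the
constant term that stems from far away. Jensen's inequality reduces the convolution to \<open>Q\<close>, whose
integral is computed by Tonelli's theorem. To keep the constant independent of \<open>p\<close>, the inequality
\<open>(a + b) powr p \<le> 2 powr p * (a powr p + b powr p)\<close> and the crude bounds \<open>m\<close>, \<open>A powr p \<le> E powr p\<close>
with \<open>E = 1 + m + A\<close> suffice, because \<open>E \<ge> 1\<close> and \<open>p > 1\<close>.\<close>
lemma near_far_convolution_bound:
  fixes f g :: "real^3 \<Rightarrow> real"
  assumes [measurable]: "f \<in> borel_measurable borel" "S \<in> sets borel"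
    and f: "\<And>Y. 0 \<le> f Y" and g: "\<And>X. 0 \<le> g X" and "1 < p" "0 < K" "0 \<le> N" "0 \<le> m"
    and L1: "(\<integral>\<^sup>+Y. ennreal (f Y) \<partial>lborel) \<le> ennreal N"
    and Lp: "(\<integral>\<^sup>+Y. ennreal (f Y powr p) \<partial>lborel) \<le> ennreal (N powr p)"
    and S: "emeasure lborel S \<le> ennreal m"
    and bound: "\<And>X. X \<in> S \<Longrightarrow> ennreal (g X) \<le> ennreal K * ((\<integral>\<^sup>+Y. ennreal (f Y) \<partial>lborel)
        + (\<integral>\<^sup>+Y. ennreal (inv_sq_near 1 (Y - X) * f Y) \<partial>lborel))"
  shows "(\<integral>\<^sup>+X. ennreal (g X powr p) * indicator S X \<partial>lborel)
    \<le> ennreal ((4 * K * (1 + m + 8 * unit_ball_vol 3) * N) powr p)"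
proof -
  define A where "A = 8 * unit_ball_vol 3"
  have A: "0 < A" by (simp add: A_def)
  have mass: "(\<integral>\<^sup>+Z. ennreal (inv_sq_near 1 (Y - Z)) \<partial>lborel) \<le> ennreal A"
      "(\<integral>\<^sup>+Y. ennreal (inv_sq_near 1 (Y - Z)) \<partial>lborel) \<le> ennreal A" for Y Z
  proof -
    have *: "(\<integral>\<^sup>+Y. ennreal (inv_sq_near 1 (Y - Z)) \<partial>lborel) \<le> ennreal A" for Z
      using nn_integral_inv_sq_near_le[of 1]
      by (subst nn_integral_lborel_translate[where f = "\<lambda>Y. ennreal (inv_sq_near 1 Y)"]) (auto simp: A_def)
    then show "(\<integral>\<^sup>+Y. ennreal (inv_sq_near 1 (Y - Z)) \<partial>lborel) \<le> ennreal A" .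
    show "(\<integral>\<^sup>+Z. ennreal (inv_sq_near 1 (Y - Z)) \<partial>lborel) \<le> ennreal A"
      using *[of Y] unfolding inv_sq_near_commute[of 1 Y] .
  qed
  define Q where "Q X = (\<integral>\<^sup>+Y. ennreal (inv_sq_near 1 (Y - X) * f Y powr p) \<partial>lborel)" for X
  have [measurable]: "Q \<in> borel_measurable borel" unfolding Q_def[abs_def] by measurable
  have "(\<integral>\<^sup>+X. Q X \<partial>lborel)
      = (\<integral>\<^sup>+Y. \<integral>\<^sup>+X. ennreal (inv_sq_near 1 (Y - X) * f Y powr p) \<partial>lborel \<partial>lborel)"
    unfolding Q_def by (rule lborel_pair.Fubini') measurable
  also have "\<dots> = (\<integral>\<^sup>+Y. ennreal (f Y powr p) * (\<integral>\<^sup>+X. ennreal (inv_sq_near 1 (Y - X)) \<partial>lborel) \<partial>lborel)"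
    by (intro nn_integral_cong, subst nn_integral_cmult[symmetric])
      (auto simp: ennreal_mult inv_sq_near_nonneg mult.commute)
  also have "\<dots> \<le> (\<integral>\<^sup>+Y. ennreal (f Y powr p) * ennreal A \<partial>lborel)"
    by (intro nn_integral_mono mult_left_mono mass) auto
  also have "\<dots> \<le> ennreal (N powr p) * ennreal A"
    using Lp by (simp add: nn_integral_multc mult_right_mono)
  finally have Q_le: "(\<integral>\<^sup>+X. Q X \<partial>lborel) \<le> ennreal (N powr p) * ennreal A" .
  have pointwise: "ennreal (g X powr p)
      \<le> ennreal ((2 * K) powr p) * (ennreal (N powr p) + ennreal (A powr (p - 1)) * Q X)" if X: "X \<in> S" for X
  proof -
    \<comment> \<open>the far term is at most \<open>N\<close>, so the excess of \<open>g / K\<close> over \<open>N\<close> bounds the near term from below\<close>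
    define t where "t = max 0 (g X / K - N)"
    have t: "0 \<le> t" and gt: "g X \<le> K * (N + t)"
      using \<open>0 < K\<close> by (auto simp: t_def max_def field_simps)
    have "ennreal t \<le> (\<integral>\<^sup>+Y. ennreal (inv_sq_near 1 (Y - X) * f Y) \<partial>lborel)" (is "_ \<le> ?T")
    proof (cases ?T)
      case (real \<tau>)
      have "ennreal (g X) \<le> ennreal K * (ennreal N + ennreal \<tau>)"
        using bound[OF X] L1 unfolding real(2)
        by (rule order_trans[OF _ mult_left_mono[OF add_right_mono]]) auto
      also have "\<dots> = ennreal (K * (N + \<tau>))"
        using real \<open>0 < K\<close> \<open>0 \<le> N\<close> by (simp flip: ennreal_plus ennreal_mult)
      finally have "g X \<le> K * (N + \<tau>)"
        using real \<open>0 < K\<close> \<open>0 \<le> N\<close> by (subst (asm) ennreal_le_iff) auto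
      then have "t \<le> \<tau>" using real \<open>0 < K\<close> by (auto simp: t_def field_simps)
      then show ?thesis unfolding real(2) by (rule ennreal_leI)
    qed simp
    then have Jensen: "ennreal (t powr p) \<le> ennreal (A powr (p - 1)) * Q X"
      unfolding Q_def using t mass(2) f A \<open>1 < p\<close>
      by (intro nn_integral_Jensen_powr) (auto simp: inv_sq_near_nonneg)
    have "K * (N + t) \<le> K * (2 * max N t)" using \<open>0 < K\<close> by (intro mult_left_mono) auto
    then have "g X \<le> 2 * K * max N t" using gt by simp
    then have "g X powr p \<le> (2 * K * max N t) powr p" using g \<open>1 < p\<close> by (intro powr_mono2) auto
    also have "\<dots> = (2 * K) powr p * max N t powr p"
      by (rule powr_mult)
    also have "\<dots> \<le> (2 * K) powr p * (N powr p + t powr p)"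
      by (intro mult_left_mono) (auto simp: max_def)
    finally have "ennreal (g X powr p) \<le> ennreal ((2 * K) powr p * (N powr p + t powr p))"
      by (rule ennreal_leI)
    also have "\<dots> = ennreal ((2 * K) powr p) * (ennreal (N powr p) + ennreal (t powr p))"
      by (simp add: ennreal_mult)
    also have "\<dots> \<le> ennreal ((2 * K) powr p) * (ennreal (N powr p) + ennreal (A powr (p - 1)) * Q X)"
      by (intro mult_left_mono add_left_mono Jensen zero_le)
    finally show ?thesis .
  qed
  have "(\<integral>\<^sup>+X. ennreal (g X powr p) * indicator S X \<partial>lborel)
      \<le> (\<integral>\<^sup>+X. ennreal ((2 * K) powr p) * (ennreal (N powr p) * indicator S X + ennreal (A powr (p - 1)) * Q X) \<partial>lborel)"
    using pointwise by (intro nn_integral_mono) (auto simp: indicator_def)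
  also have "\<dots> = ennreal ((2 * K) powr p) * (ennreal (N powr p) * emeasure lborel S
      + ennreal (A powr (p - 1)) * (\<integral>\<^sup>+X. Q X \<partial>lborel))"
    by (simp add: nn_integral_cmult nn_integral_add nn_integral_cmult_indicator)
  also have "\<dots> \<le> ennreal ((2 * K) powr p) * (ennreal (N powr p) * ennreal m
      + ennreal (A powr (p - 1)) * (ennreal (N powr p) * ennreal A))"
    using S Q_le by (intro mult_left_mono add_mono) auto
  also have "\<dots> = ennreal ((2 * K) powr p * (N powr p * m + A powr (p - 1) * (N powr p * A)))"
    using A \<open>0 \<le> m\<close> by (simp add: ennreal_mult ennreal_plus)
  also have "\<dots> \<le> ennreal ((4 * K * (1 + m + A) * N) powr p)"
  proof (rule ennreal_leI)
    define E where "E = 1 + m + A"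
    have E: "1 \<le> E" "m \<le> E" "A \<le> E" using A \<open>0 \<le> m\<close> by (auto simp: E_def)
    have "m \<le> E powr p" using E \<open>1 < p\<close> powr_mono[of 1 p E] by simp
    moreover have "A powr p \<le> E powr p" using E A \<open>1 < p\<close> by (intro powr_mono2) auto
    moreover have "2 * E powr p \<le> (2 * E) powr p"
      using E \<open>1 < p\<close> powr_mono[of 1 p 2] by (simp add: powr_mult)
    ultimately have sum: "m + A powr p \<le> (2 * E) powr p" by linarith
    have "A powr (p - 1) * A = A powr p" using A by (simp add: powr_diff)
    then have "(2 * K) powr p * (N powr p * m + A powr (p - 1) * (N powr p * A))
        = (2 * K) powr p * N powr p * (m + A powr p)"
      by (simp add: algebra_simps)
    also have "\<dots> \<le> (2 * K) powr p * N powr p * (2 * E) powr p"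
      using sum by (intro mult_left_mono) auto
    also have "\<dots> = ((2 * K) * N * (2 * E)) powr p"
      using E \<open>0 < K\<close> \<open>0 \<le> N\<close> by (simp only: powr_mult)
    finally show "(2 * K) powr p * (N powr p * m + A powr (p - 1) * (N powr p * A))
        \<le> (4 * K * (1 + m + A) * N) powr p"
      by (simp add: E_def mult_ac)
  qed
  finally show ?thesis by (simp add: A_def)
qed

section \<open>The weight in the inverse square potential\<close>

text \<open>The weight \<open>rad Y\<close> is at most \<open>R + d\<close> with \<open>d = \<bar>X - Y\<bar>\<close>. For \<open>d \<ge> 1\<close> it is absorbed by the decay
of the kernel, for \<open>d < 1\<close> it is bounded.\<close>
lemma inv_sq_potential_near_far:
  assumes [measurable]: "f \<in> borel_measurable borel" and f: "\<And>Y. 0 \<le> f Y"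
    and g: "AE Y in lborel. g Y \<le> rad Y * f Y" and "0 < R" "rad X \<le> R"
  shows "inv_sq_potential g X \<le> ennreal (R + 1) * ((\<integral>\<^sup>+Y. ennreal (f Y) \<partial>lborel)
        + (\<integral>\<^sup>+Y. ennreal (inv_sq_near 1 (Y - X) * f Y) \<partial>lborel))"
proof -
  have "inv_sq_potential g X \<le> (\<integral>\<^sup>+Y. ennreal (R + 1) * (ennreal (f Y) + ennreal (inv_sq_near 1 (Y - X) * f Y)) \<partial>lborel)"
    unfolding inv_sq_potential_def
  proof (rule nn_integral_mono_AE)
    show "AE Y in lborel. ennreal (g Y / (norm (X - Y))\<^sup>2)
        \<le> ennreal (R + 1) * (ennreal (f Y) + ennreal (inv_sq_near 1 (Y - X) * f Y))"
      using g
    proof eventually_elim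
      case (elim Y)
      define d where "d = norm (X - Y)"
      have "rad Y \<le> rad X + rad (Y - X)"
        using norm_triangle_ineq[of "vector [X $ 1, X $ 2] :: real^2" "vector [(Y - X) $ 1, (Y - X) $ 2]"]
        by (simp add: rad_def norm_vec_def L2_set_def sum_2)
      moreover have "rad (Y - X) \<le> d"
        by (simp add: rad_def d_def norm_vec_def L2_set_def sum_3 power2_commute)
      ultimately have "rad Y \<le> R + d" using \<open>rad X \<le> R\<close> by linarith
      then have "g Y / d\<^sup>2 \<le> (R + d) * f Y / d\<^sup>2"
        using elim f[of Y] mult_right_mono[of "rad Y" "R + d" "f Y"] by (intro divide_right_mono) auto
      also have "\<dots> \<le> (R + 1) * (f Y + inv_sq_near 1 (Y - X) * f Y)"
      proof -
        have "(R + d) / d\<^sup>2 \<le> (R + 1) * (1 + inv_sq_near 1 (Y - X))"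
        proof (cases "d < 1")
          case True
          then have "inv_sq_near 1 (Y - X) = 1 / d\<^sup>2"
            by (simp add: inv_sq_near_def d_def norm_minus_commute)
          moreover have "(R + d) / d\<^sup>2 \<le> (R + 1) / d\<^sup>2" using True by (intro divide_right_mono) auto
          ultimately show ?thesis using \<open>0 < R\<close> by (simp add: distrib_left)
        next
          case False
          then have "d \<le> d\<^sup>2" by (simp add: power2_eq_square mult_le_cancel_left1)
          moreover have "R \<le> R * d\<^sup>2" using False \<open>0 < R\<close> by simp
          ultimately have "R + d \<le> (R + 1) * d\<^sup>2" by (simp add: distrib_right)
          then have "(R + d) / d\<^sup>2 \<le> R + 1" using False by (simp add: divide_le_eq)
          also have "\<dots> \<le> (R + 1) * (1 + inv_sq_near 1 (Y - X))"
            using \<open>0 < R\<close> inv_sq_near_nonneg[of 1 "Y - X"] by simp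
          finally show ?thesis .
        qed
        then have "(R + d) / d\<^sup>2 * f Y \<le> (R + 1) * (1 + inv_sq_near 1 (Y - X)) * f Y"
          using f by (intro mult_right_mono) auto
        then show ?thesis by (simp add: algebra_simps)
      qed
      finally have "ennreal (g Y / (norm (X - Y))\<^sup>2) \<le> ennreal ((R + 1) * (f Y + inv_sq_near 1 (Y - X) * f Y))"
        unfolding d_def by (rule ennreal_leI)
      also have "\<dots> = ennreal (R + 1) * (ennreal (f Y) + ennreal (inv_sq_near 1 (Y - X) * f Y))"
        using \<open>0 < R\<close> f inv_sq_near_nonneg[of 1 "Y - X"] by (simp add: ennreal_mult ennreal_plus del: ennreal_1)
      finally show ?case .
    qed
  qed
  also have "\<dots> = ennreal (R + 1) * ((\<integral>\<^sup>+Y. ennreal (f Y) \<partial>lborel)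
        + (\<integral>\<^sup>+Y. ennreal (inv_sq_near 1 (Y - X) * f Y) \<partial>lborel))"
    by (simp add: nn_integral_cmult nn_integral_add)
  finally show ?thesis .
qed

section \<open>Smooth fields, the axis and the cylinder\<close>

lemma norm_e_theta [simp]: "norm (e_theta \<theta>) = 1"
  by (simp add: e_theta_def norm_vec_def L2_set_def sum_3)

text \<open>On the axis the quotient \<open>w / r\<close> has the default value \<open>0\<close> and does not determine \<open>w\<close>, so the
identity \<open>w = r * (w / r)\<close> is available almost everywhere.\<close>
lemma AE_rad_nonzero: "AE Y in lborel. rad Y \<noteq> 0"
proof -
  have "negligible {Y :: real^3. Y $ 1 = 0}"
    using negligible_standard_hyperplane[of "axis 1 1 :: real^3" 0]
    by (simp add: axis_in_Basis_iff inner_axis)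
  moreover have "{Y :: real^3. Y $ 1 = 0} \<in> sets borel" by measurable
  ultimately have "{Y :: real^3. Y $ 1 = 0} \<in> null_sets lborel"
    by (simp add: negligible_iff_null_sets null_sets_completion_iff)
  then have "AE Y in lborel. Y \<notin> {Y :: real^3. Y $ 1 = 0}" by (rule AE_not_in)
  then show ?thesis by eventually_elim (auto simp: rad_def sum_power2_eq_zero_iff)
qed

lemma smooth_imp_continuous: "smooth u \<Longrightarrow> continuous_on UNIV u"
  unfolding smooth_def by (metis C_class.simps(1))

lemma smooth_imp_continuous_curl:
  assumes "smooth u"
  shows "continuous_on UNIV (curl u)"
proof -
  have "C_class (Suc 0) u" using assms unfolding smooth_def by blast
  then have "continuous_on UNIV (partial i u)" for i by simp
  then have "continuous_on UNIV (\<lambda>X. curl u X $ j)" for j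
    using exhaust_3[of j]
    by (elim disjE) (simp_all add: curl_def continuous_on_diff continuous_on_component)
  then have "continuous_on UNIV (\<lambda>X. \<chi> j. curl u X $ j)"
    by (rule continuous_on_vec_lambda)
  then show ?thesis by simp
qed

lemma cylinder_borel_bounded:
  shows "cylinder R \<in> sets borel" "bounded (cylinder R)"
proof -
  have eq: "cylinder R = {X. rad X < R \<and> X $ 3 \<in> {-R..R}}"
    by (simp add: cylinder_def rad_def norm_vec_def L2_set_def sum_2)
  show "cylinder R \<in> sets borel" unfolding eq rad_def by measurable
  have "norm X \<le> R + R" if "X \<in> cylinder R" for X
  proof -
    have "norm X = sqrt ((rad X)\<^sup>2 + (X $ 3)\<^sup>2)"
      by (simp add: rad_def norm_vec_def L2_set_def sum_3)
    also have "\<dots> \<le> \<bar>rad X\<bar> + \<bar>X $ 3\<bar>" by (rule sqrt_sum_squares_le_sum_abs)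
    also have "\<dots> \<le> R + R" using that by (auto simp: eq rad_def)
    finally show ?thesis .
  qed
  then show "bounded (cylinder R)" by (auto simp: bounded_iff)
qed

section \<open>Integrals and norms\<close>

lemma in_Lp_nn_integral:
  assumes "in_Lp p UNIV \<phi>" "0 < p"
  shows "(\<integral>\<^sup>+X. ennreal (norm (\<phi> X) powr p) \<partial>lborel) = ennreal (Lp_norm p UNIV \<phi> powr p)"
proof -
  have "integrable lborel (\<lambda>X. norm (\<phi> X) powr p)"
    using assms by (simp add: in_Lp_def set_integrable_def)
  then have "(\<integral>\<^sup>+X. ennreal (norm (\<phi> X) powr p) \<partial>lborel) = ennreal (LINT X|lborel. norm (\<phi> X) powr p)"
    by (intro nn_integral_eq_integral) auto
  moreover have "0 \<le> (LINT X|lborel. norm (\<phi> X) powr p)" by (intro integral_nonneg_AE) auto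
  ultimately show ?thesis
    using \<open>0 < p\<close> by (simp add: Lp_norm_def set_lebesgue_integral_def powr_powr)
qed

lemma in_Lp_and_norm_le:
  fixes \<phi> :: "real^3 \<Rightarrow> real^3"
  assumes [measurable]: "\<phi> \<in> borel_measurable borel" "S \<in> sets borel"
    and "0 < p" "0 \<le> B"
    and le: "(\<integral>\<^sup>+X. ennreal (norm (\<phi> X) powr p) * indicator S X \<partial>lborel) \<le> ennreal (B powr p)"
  shows "in_Lp p S \<phi> \<and> Lp_norm p S \<phi> \<le> B"
proof
  have eq: "ennreal (norm (indicator S X *\<^sub>R norm (\<phi> X) powr p))
      = ennreal (norm (\<phi> X) powr p) * indicator S X" for X
    by (simp add: indicator_def)
  have int: "integrable lborel (\<lambda>X. indicator S X *\<^sub>R norm (\<phi> X) powr p)"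
  proof (rule integrableI_bounded)
    show "(\<integral>\<^sup>+X. ennreal (norm (indicator S X *\<^sub>R norm (\<phi> X) powr p)) \<partial>lborel) < \<infinity>"
      unfolding eq using le by (rule le_less_trans) simp
  qed simp
  then show "in_Lp p S \<phi>"
    by (simp add: in_Lp_def set_integrable_def set_borel_measurable_def)
  have "ennreal (LINT X|lborel. indicator S X *\<^sub>R norm (\<phi> X) powr p)
      = (\<integral>\<^sup>+X. ennreal (indicator S X *\<^sub>R norm (\<phi> X) powr p) \<partial>lborel)"
    using int by (intro nn_integral_eq_integral[symmetric]) auto
  also have "\<dots> = (\<integral>\<^sup>+X. ennreal (norm (\<phi> X) powr p) * indicator S X \<partial>lborel)"
    by (intro nn_integral_cong) (simp add: indicator_def)
  also note le
  finally have "(LINT X|lborel. indicator S X *\<^sub>R norm (\<phi> X) powr p) \<le> B powr p"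
    by (subst (asm) ennreal_le_iff) auto
  then have "Lp_norm p S \<phi> \<le> (B powr p) powr (1 / p)"
    unfolding Lp_norm_def set_lebesgue_integral_def
    using \<open>0 < p\<close> by (intro powr_mono2 integral_nonneg_AE) auto
  then show "Lp_norm p S \<phi> \<le> B" using \<open>0 < p\<close> \<open>0 \<le> B\<close> by (simp add: powr_powr)
qed

theorem proposition3p1:
  fixes R :: real
  assumes "R > 0"
  shows "\<exists>C>0. \<forall>(u :: real^3 \<Rightarrow> real^3) (w :: real \<Rightarrow> real \<Rightarrow> real) (\<psi> :: real \<Rightarrow> real \<Rightarrow> real) (p :: real).
    smooth u \<longrightarrow>
    axisymmetric_no_swirl u \<longrightarrow>
    (\<forall>X. divergence u X = 0) \<longrightarrow>
    (\<forall>X. curl u X = swirl_field w X) \<longrightarrow>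
    stream_function u w \<psi> \<longrightarrow>
    1 < p \<longrightarrow>
    in_Lp 1 UNIV (\<lambda>X. axi w X / rad X) \<longrightarrow>
    in_Lp p UNIV (\<lambda>X. axi w X / rad X) \<longrightarrow>
    in_Lp p (cylinder R) u \<and>
    Lp_norm p (cylinder R) u \<le> C * L1_Lp_norm p (\<lambda>X. axi w X / rad X)"
proof -
  define m where "m = measure lborel (cylinder R)"
  define C where "C = 4 * (R + 1) * (1 + m + 8 * unit_ball_vol 3)"
  have cyl [measurable]: "cylinder R \<in> sets borel" by (rule cylinder_borel_bounded)
  have m: "emeasure lborel (cylinder R) = ennreal m" "0 \<le> m"
    using emeasure_bounded_finite[OF cylinder_borel_bounded(2)[of R]]
    by (simp_all add: m_def emeasure_eq_ennreal_measure less_top)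
  have "0 < unit_ball_vol 3" by simp
  then have "0 < 1 + m + 8 * unit_ball_vol 3" using m(2) by linarith
  then have "0 < C" using \<open>R > 0\<close> by (simp add: C_def)
  moreover have "in_Lp p (cylinder R) u \<and>
      Lp_norm p (cylinder R) u \<le> C * L1_Lp_norm p (\<lambda>X. axi w X / rad X)"
    if "smooth u" and curl: "\<forall>X. curl u X = swirl_field w X" and stream: "stream_function u w \<psi>"
      and "1 < p" and L1: "in_Lp 1 UNIV (\<lambda>X. axi w X / rad X)" and Lp: "in_Lp p UNIV (\<lambda>X. axi w X / rad X)"
    for u :: "real^3 \<Rightarrow> real^3" and w \<psi> :: "real \<Rightarrow> real \<Rightarrow> real" and p :: real
  proof -
    define \<omega> where "\<omega> X = axi w X / rad X" for X
    define f where "f X = \<bar>\<omega> X\<bar>" for X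
    define N where "N = L1_Lp_norm p \<omega>"
    note L1 = L1[folded \<omega>_def] and Lp = Lp[folded \<omega>_def]
    have [measurable]: "\<omega> \<in> borel_measurable borel"
      using L1 by (simp add: in_Lp_def set_borel_measurable_def)
    have f: "f \<in> borel_measurable borel" "\<And>Y. 0 \<le> f Y" by (simp_all add: f_def[abs_def])
    have norms: "0 \<le> Lp_norm 1 UNIV \<omega>" "0 \<le> Lp_norm p UNIV \<omega>" by (simp_all add: Lp_norm_def)
    then have N: "0 \<le> N" "Lp_norm 1 UNIV \<omega> \<le> N" "Lp_norm p UNIV \<omega> \<le> N"
      by (simp_all add: N_def L1_Lp_norm_def)
    have f_L1: "(\<integral>\<^sup>+Y. ennreal (f Y) \<partial>lborel) \<le> ennreal N"
      using in_Lp_nn_integral[OF L1] N norms by (simp add: f_def ennreal_leI)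
    have f_Lp: "(\<integral>\<^sup>+Y. ennreal (f Y powr p) \<partial>lborel) \<le> ennreal (N powr p)"
      using in_Lp_nn_integral[OF Lp] N norms \<open>1 < p\<close> by (simp add: f_def ennreal_leI powr_mono2)
    have F: "curl u = swirl_field w" using curl by auto
    have newton: "has_newton_potential (swirl_field w) (swirl_field \<psi>)"
      using stream by (auto simp: stream_function_def has_newton_potential_def)
    have weight: "AE Y in lborel. norm (swirl_field w Y) \<le> rad Y * f Y"
      using AE_rad_nonzero by eventually_elim (simp add: swirl_field_def f_def \<omega>_def rad_def)
    have bound: "ennreal (norm (u X)) \<le> ennreal (R + 1) * ((\<integral>\<^sup>+Y. ennreal (f Y) \<partial>lborel)
        + (\<integral>\<^sup>+Y. ennreal (inv_sq_near 1 (Y - X) * f Y) \<partial>lborel))" if "X \<in> cylinder R" for X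
    proof -
      have "ennreal (norm (u X)) = ennreal (norm (curl (swirl_field \<psi>) X))"
        using stream by (simp add: stream_function_def)
      also have "\<dots> \<le> inv_sq_potential (\<lambda>Y. norm (swirl_field w Y)) X"
        using smooth_imp_continuous_curl[OF \<open>smooth u\<close>] newton stream
        by (intro biot_savart_bound) (auto simp: F stream_function_def)
      also have "\<dots> \<le> ennreal (R + 1) * ((\<integral>\<^sup>+Y. ennreal (f Y) \<partial>lborel)
          + (\<integral>\<^sup>+Y. ennreal (inv_sq_near 1 (Y - X) * f Y) \<partial>lborel))"
        using that \<open>R > 0\<close>
        by (intro inv_sq_potential_near_far f weight)
          (auto simp: cylinder_def rad_def norm_vec_def L2_set_def sum_2)
      finally show ?thesis .
    qed
    have "(\<integral>\<^sup>+X. ennreal (norm (u X) powr p) * indicator (cylinder R) X \<partial>lborel)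
        \<le> ennreal ((4 * (R + 1) * (1 + m + 8 * unit_ball_vol 3) * N) powr p)"
      using \<open>1 < p\<close> \<open>R > 0\<close> N m f f_L1 f_Lp bound by (intro near_far_convolution_bound) auto
    then have "in_Lp p (cylinder R) u \<and> Lp_norm p (cylinder R) u \<le> C * N"
      using \<open>1 < p\<close> \<open>0 < C\<close> N smooth_imp_continuous[OF \<open>smooth u\<close>]
      by (intro in_Lp_and_norm_le) (auto simp: C_def intro: borel_measurable_continuous_onI)
    then show ?thesis by (simp add: N_def \<omega>_def[abs_def])
  qed
  ultimately show ?thesis by blast
qed

end
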